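(* Fix integers $M,N\ge1$ and $A=(a_{ij})\in\mathbb{C}^{M\times N}$. (a) For every polynomial $f\in\mathbb{C}[z]$, $(f_\diamond(A))_{00}=f(a_{00})$, and for all nonzero $(i,j)\in\mathcal{K}_{M,N}$, $$(f_\diamond(A))_{ij}=\sum_{\ell=1}^{i+j}f^{(\ell)}(a_{00})\sum_{S\in\mathcal{P}^*_\ell(i,j)}\frac{1}{\prod_{(m,n)\in\mathcal{K}^*_{M,N}}c_S(m,n)!}\prod_{(p,q)\in S}a_{p,q},$$ where the product over the multiset $S$ is taken with multiplicity. (b) If $\kappa\in\{1,\dots,M+N-2\}$ is the smallest integer in this range such that $$\sum_{S\in\mathcal{P}^*_\kappa(i,j)}\frac{1}{\prod_{(m,n)\in\mathcal{K}^*_{M,N}}c_S(m,n)!}\prod_{(p,q)\in S}a_{p,q}=0$$ for all $(i,j)\in\mathcal{K}_{M,N}$ with $i+j\ge\kappa$ (products over $S$ with multiplicity), then $(z-a_{00})^\kappa$ is the minimal polynomial of $A$ for the Jury product. If no such $\kappa\in\{1,\dots,M+N-2\}$ exists, then $(z-a_{00})^{M+N-1}$ is the minimal polynomial of $A$ for the Jury product.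
   Context: $\mathcal{K}_{M,N}:=\{0,\dots,M-1\}\times\{0,\dots,N-1\}$ and $\mathcal{K}^*_{M,N}:=\mathcal{K}_{M,N}\setminus\{(0,0)\}$; matrices in $\mathbb{C}^{M\times N}$ are indexed by $\mathcal{K}_{M,N}$. The convolution (Jury product) of $A,B\in\mathbb{C}^{M\times N}$ is $(A\diamond B)_{ij}:=\sum_{\ell=0}^i\sum_{\kappa=0}^j a_{\ell,\kappa}b_{i-\ell,j-\kappa}$; its identity is $\mathrm{I}_\diamond$, with $(0,0)$ entry $1$ and all other entries $0$. $A^{\diamond0}:=\mathrm{I}_\diamond$, $A^{\diamond k}:=A\diamond\cdots\diamond A$ ($k$ factors), and for $f(z)=c_0+c_1z+\dots+c_nz^n$, $f_\diamond(A):=c_0\mathrm{I}_\diamond+c_1A+\dots+c_nA^{\diamond n}$. For $\ell\ge1$ and $(i,j)\in\mathcal{K}^*_{M,N}$, $\mathcal{P}^*_\ell(i,j)$ is the set of all multisets $S$ of $\ell$ elements (counted with multiplicity) of $\mathcal{K}^*_{M,N}$ with $\sum_{(p,q)\in S}(p,q)=(i,j)$; $c_S(m,n)$ is the multiplicity of $(m,n)$ in $S$. The minimal (Cayley--Hamilton) polynomial of $A$ for the Jury product is a nonzero monic $p\in\mathbb{C}[z]$ with $p_\diamond(A)=0$ such that there is no nonzero monic $q\in\mathbb{C}[z]$ with $\deg q<\deg p$ and $q_\diamond(A)=0$. *)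

theory Defs
  imports
    "Jordan_Normal_Form.Matrix"
    "HOL-Computational_Algebra.Polynomial"
    "HOL-Library.Multiset"
    "HOL-Library.Product_Plus"
begin

definition index_set :: "nat \<Rightarrow> nat \<Rightarrow> (nat \<times> nat) set" where
  "index_set M N = {0..<M} \<times> {0..<N}"

definition index_set_star :: "nat \<Rightarrow> nat \<Rightarrow> (nat \<times> nat) set" where
  "index_set_star M N = index_set M N - {(0, 0)}"

definition jury_prod :: "complex mat \<Rightarrow> complex mat \<Rightarrow> complex mat" (infixl "\<diamond>" 70) where
  "A \<diamond> B = mat (dim_row A) (dim_col A)
     (\<lambda>(i, j). \<Sum>l = 0..i. \<Sum>k = 0..j. A $$ (l, k) * B $$ (i - l, j - k))"

definition jury_one :: "nat \<Rightarrow> nat \<Rightarrow> complex mat" where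
  "jury_one M N = mat M N (\<lambda>(i, j). if i = 0 \<and> j = 0 then 1 else 0)"

primrec jury_power :: "complex mat \<Rightarrow> nat \<Rightarrow> complex mat" where
  "jury_power A 0 = jury_one (dim_row A) (dim_col A)"
| "jury_power A (Suc k) = jury_power A k \<diamond> A"

(* The linear combination of Jury powers is taken entrywise, since the type of matrices
   has no dimension-independent zero and hence no big sum operator. *)
definition jury_poly :: "complex poly \<Rightarrow> complex mat \<Rightarrow> complex mat" where
  "jury_poly f A = mat (dim_row A) (dim_col A)
     (\<lambda>ij. \<Sum>k = 0..degree f. coeff f k * jury_power A k $$ ij)"

(* Addition of index pairs is componentwise (Product_Plus). *)
definition star_partitions :: "nat \<Rightarrow> nat \<Rightarrow> nat \<Rightarrow> nat \<times> nat \<Rightarrow> (nat \<times> nat) multiset set" where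
  "star_partitions M N l ij =
     {S. size S = l \<and> set_mset S \<subseteq> index_set_star M N \<and> \<Sum>\<^sub># S = ij}"

lemma finite_star_partitions: "finite (star_partitions M N l ij)"
proof (rule finite_subset)
  let ?L = "{xs. set xs \<subseteq> index_set_star M N \<and> length xs = l}"
  show "star_partitions M N l ij \<subseteq> mset ` ?L"
  proof
    fix S assume S: "S \<in> star_partitions M N l ij"
    obtain xs where "S = mset xs" by (metis ex_mset)
    with S show "S \<in> mset ` ?L" by (auto simp: star_partitions_def)
  qed
  show "finite (mset ` ?L)"
    by (intro finite_imageI finite_lists_length_eq) (simp add: index_set_star_def index_set_def)
qed

definition partition_sum :: "nat \<Rightarrow> nat \<Rightarrow> complex mat \<Rightarrow> nat \<Rightarrow> nat \<times> nat \<Rightarrow> complex" where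
  "partition_sum M N A l ij =
     (\<Sum>S \<in> star_partitions M N l ij.
        1 / (\<Prod>mn \<in> index_set_star M N. fact (count S mn)) * (\<Prod>pq \<in># S. A $$ pq))"

definition partition_sums_vanish :: "nat \<Rightarrow> nat \<Rightarrow> complex mat \<Rightarrow> nat \<Rightarrow> bool" where
  "partition_sums_vanish M N A \<kappa> \<longleftrightarrow>
     (\<forall>(i, j) \<in> index_set M N. i + j \<ge> \<kappa> \<longrightarrow> partition_sum M N A \<kappa> (i, j) = 0)"

definition jury_minimal_poly :: "complex mat \<Rightarrow> complex poly \<Rightarrow> bool" where
  "jury_minimal_poly A p \<longleftrightarrow>
     p \<noteq> 0 \<and> lead_coeff p = 1 \<and> jury_poly p A = 0\<^sub>m (dim_row A) (dim_col A) \<and>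
     \<not> (\<exists>q. q \<noteq> 0 \<and> lead_coeff q = 1 \<and> degree q < degree p \<and>
            jury_poly q A = 0\<^sub>m (dim_row A) (dim_col A))"

end

theory Submission
  imports Defs "HOL-Computational_Algebra.Formal_Power_Series"
begin

text \<open>
  Reading a matrix as the bivariate power series \<open>F\<close> with coefficients \<open>a\<^sub>i\<^sub>j\<close> turns the Jury product
  into multiplication modulo \<open>(x\<^sup>M, y\<^sup>N)\<close>. Put \<open>a = a\<^sub>0\<^sub>0\<close> and \<open>B = F - a\<close>. By the multinomial theorem
  the coefficients of \<open>B\<^sup>l\<close> are \<open>l!\<close> times the partition sums, so (a) is the Taylor expansion of \<open>f\<close>
  at \<open>a\<close>. Since \<open>B\<close> has no constant term it is nilpotent modulo \<open>(x\<^sup>M, y\<^sup>N)\<close>, and the minimal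
  polynomial is \<open>(z - a)\<^sup>\<kappa>\<close> with \<open>\<kappa>\<close> its nilpotency index.
\<close>

text \<open>Composing with z + a moves the expansion point to 0, where coefficients are derivatives
  over factorials; composing with z - a moves it back.\<close>

lemma poly_taylor:
  fixes p :: "'a :: field_char_0 poly"
  shows "p = (\<Sum>l\<le>degree p. smult (poly ((pderiv ^^ l) p) a / fact l) ([:-a, 1:] ^ l))"
proof -
  have deriv: "(pderiv ^^ l) (pcompose p [:a, 1:]) = pcompose ((pderiv ^^ l) p) [:a, 1:]" for l
    by (induction l) (simp_all add: pderiv_pcompose pderiv_pCons)
  have coeff: "coeff (pcompose p [:a, 1:]) l = poly ((pderiv ^^ l) p) a / fact l" for l
  proof -
    have "poly ((pderiv ^^ l) p) a = coeff ((pderiv ^^ l) (pcompose p [:a, 1:])) 0"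
      by (simp add: deriv poly_0_coeff_0 [symmetric] poly_pcompose)
    also have "\<dots> = fact l * coeff (pcompose p [:a, 1:]) l"
      by (simp add: coeff_higher_pderiv pochhammer_fact)
    finally show ?thesis by simp
  qed
  have "p = pcompose (pcompose p [:a, 1:]) [:-a, 1:]"
    by (simp add: pcompose_assoc [symmetric] pcompose_pCons)
  also have "\<dots> = (\<Sum>l\<le>degree p. smult (coeff (pcompose p [:a, 1:]) l) ([:-a, 1:] ^ l))"
    by (subst pcompose_altdef)
      (simp add: poly_altdef degree_pcompose coeff_map_poly degree_map_poly)
  finally show ?thesis by (simp only: coeff)
qed

lemma higher_pderiv_eq_0_of_degree_less:
  fixes p :: "'a :: {comm_semiring_1, semiring_no_zero_divisors} poly"
  assumes "degree p < l"
  shows "(pderiv ^^ l) p = 0"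
  using assms by (intro poly_eqI) (simp add: coeff_higher_pderiv coeff_eq_0)

subsection \<open>Bivariate power series\<close>

definition const2 :: "'a :: comm_ring_1 \<Rightarrow> 'a fps fps" where
  "const2 c = fps_const (fps_const c)"

definition coeff2 :: "'a fps fps \<Rightarrow> nat \<Rightarrow> nat \<Rightarrow> 'a" where
  "coeff2 X i j = fps_nth (fps_nth X i) j"

lemma coeff2_add [simp]: "coeff2 (X + Y) i j = coeff2 X i j + coeff2 Y i j"
  by (simp add: coeff2_def)

lemma coeff2_diff [simp]:
  fixes X :: "'a :: comm_ring_1 fps fps"
  shows "coeff2 (X - Y) i j = coeff2 X i j - coeff2 Y i j"
  by (simp add: coeff2_def)

lemma coeff2_sum: "coeff2 (\<Sum>x\<in>S. X x) i j = (\<Sum>x\<in>S. coeff2 (X x) i j)"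
  by (simp add: coeff2_def fps_sum_nth)

lemma coeff2_1: "coeff2 1 i j = (if i = 0 \<and> j = 0 then 1 else 0)"
  by (simp add: coeff2_def)

lemma coeff2_const2: "coeff2 (const2 c) i j = (if i = 0 \<and> j = 0 then c else 0)"
  by (simp add: coeff2_def const2_def)

lemma coeff2_const2_mult [simp]: "coeff2 (const2 c * X) i j = c * coeff2 X i j"
  by (simp add: coeff2_def const2_def)

lemma coeff2_mult:
  "coeff2 (X * Y) i j = (\<Sum>l=0..i. \<Sum>k=0..j. coeff2 X l k * coeff2 Y (i - l) (j - k))"
  by (simp add: coeff2_def fps_mult_nth fps_sum_nth)

text \<open>Scalars are lifted to constant series so that evaluation stays inside one commutative
  ring; the rules below make it an algebra homomorphism in \<open>f\<close>.\<close>

definition eval2 :: "'a :: comm_ring_1 fps fps \<Rightarrow> 'a poly \<Rightarrow> 'a fps fps" where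
  "eval2 X f = poly (map_poly const2 f) X"

lemma const2_0 [simp]: "const2 0 = 0"
  and const2_1 [simp]: "const2 1 = 1"
  and const2_add: "const2 (c + d) = const2 c + const2 d"
  and const2_mult: "const2 (c * d) = const2 c * const2 d"
  and const2_minus: "const2 (- c) = - const2 c"
  by (simp_all add: const2_def fps_const_neg [symmetric] del: fps_const_neg)

lemma eval2_0 [simp]: "eval2 X 0 = 0"
  by (simp add: eval2_def)

lemma eval2_pCons [simp]: "eval2 X (pCons c f) = const2 c + X * eval2 X f"
  by (simp add: eval2_def map_poly_pCons)

lemma eval2_1 [simp]: "eval2 X 1 = 1"
  by (simp add: one_pCons)

lemma eval2_add [simp]: "eval2 X (f + g) = eval2 X f + eval2 X g"
  by (induction f g rule: poly_induct2) (simp_all add: const2_add algebra_simps)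

lemma eval2_smult [simp]: "eval2 X (smult c f) = const2 c * eval2 X f"
  by (induction f) (simp_all add: const2_mult algebra_simps)

lemma eval2_mult [simp]: "eval2 X (f * g) = eval2 X f * eval2 X g"
  by (induction f) (simp_all add: algebra_simps)

lemma eval2_power [simp]: "eval2 X (f ^ n) = eval2 X f ^ n"
  by (induction n) simp_all

lemma eval2_sum: "eval2 X (\<Sum>x\<in>S. f x) = (\<Sum>x\<in>S. eval2 X (f x))"
  by (induction S rule: infinite_finite_induct) simp_all

lemma eval2_altdef: "eval2 X f = (\<Sum>k=0..degree f. const2 (coeff f k) * X ^ k)"
proof -
  have "f = (\<Sum>k\<le>degree f. smult (coeff f k) ([:0, 1:] ^ k))"
    using poly_as_sum_of_monoms [of f] by (simp add: monom_altdef)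
  then have "eval2 X f = (\<Sum>k\<le>degree f. eval2 X (smult (coeff f k) ([:0, 1:] ^ k)))"
    by (metis eval2_sum)
  then show ?thesis by (simp add: atLeast0AtMost)
qed

subsection \<open>Partition sums\<close>

lemma star_partitions_0:
  "star_partitions M N 0 ij = (if ij = 0 then {{#}} else {})"
  by (auto simp: star_partitions_def)

lemma partition_sum_0: "partition_sum M N A 0 (i, j) = (if i = 0 \<and> j = 0 then 1 else 0)"
  by (simp add: partition_sum_def star_partitions_0 zero_prod_def)

lemma size_le_sum_mset:
  assumes "(0, 0) \<notin># S"
  shows "size S \<le> fst (\<Sum>\<^sub># S) + snd (\<Sum>\<^sub># S)"
  using assms by (induction S) (auto simp: fst_add snd_add)

text \<open>Each part other than (0,0) adds at least 1 to the coordinate sum, so there are no such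
  multisets. This cuts the Taylor sum off at i + j and yields nilpotency.\<close>

lemma partition_sum_eq_0:
  assumes "l > i + j"
  shows "partition_sum M N A l (i, j) = 0"
proof -
  have "S \<notin> star_partitions M N l (i, j)" for S
  proof
    assume S: "S \<in> star_partitions M N l (i, j)"
    then have "(0, 0) \<notin># S" by (auto simp: star_partitions_def index_set_star_def)
    from size_le_sum_mset [OF this] S assms show False by (simp add: star_partitions_def)
  qed
  then have "star_partitions M N l (i, j) = {}" by blast
  then show ?thesis by (simp add: partition_sum_def)
qed

definition partition_weight :: "nat \<Rightarrow> nat \<Rightarrow> complex mat \<Rightarrow> (nat \<times> nat) multiset \<Rightarrow> complex" where
  "partition_weight M N A S =
     1 / (\<Prod>mn \<in> index_set_star M N. fact (count S mn)) * (\<Prod>pq \<in># S. A $$ pq)"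

lemma finite_index_set_star [simp]: "finite (index_set_star M N)"
  by (simp add: index_set_star_def index_set_def)

text \<open>The new copy of \<open>x\<close> multiplies the factorial of its multiplicity by exactly
  the factor on the left, and the product of entries by \<open>A $$ x\<close>.\<close>

lemma partition_weight_add_mset:
  assumes "x \<in> index_set_star M N"
  shows "of_nat (count (add_mset x S) x) * partition_weight M N A (add_mset x S) =
         A $$ x * partition_weight M N A S"
proof -
  let ?K = "index_set_star M N"
  let ?R = "\<Prod>y\<in>?K - {x}. fact (count S y) :: complex"
  have 1: "(\<Prod>y\<in>?K. fact (count (add_mset x S) y)) =
    of_nat (Suc (count S x)) * (fact (count S x) * ?R)"
  proof -
    have "(\<Prod>y\<in>?K - {x}. fact (count (add_mset x S) y)) = ?R"
      by (intro prod.cong) auto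
    then show ?thesis using assms by (subst prod.remove [of _ x]) (simp_all add: mult.assoc)
  qed
  have 2: "(\<Prod>y\<in>?K. fact (count S y)) = fact (count S x) * ?R"
    using assms by (subst prod.remove [of _ x]) auto
  have "?R \<noteq> 0" by simp
  moreover have "(of_nat (Suc (count S x)) :: complex) \<noteq> 0"
    by (rule of_nat_neq_0)
  ultimately show ?thesis
    unfolding partition_weight_def 1 2
    by (simp add: divide_simps del: of_nat_Suc)
qed

lemma sum_count_index_set_star:
  assumes "S \<in> star_partitions M N l ij"
  shows "(\<Sum>x\<in>index_set_star M N. count S x) = l"
proof -
  have "size S = (\<Sum>x\<in>index_set_star M N. count S x)"
    unfolding size_multiset_overloaded_eq
    using assms by (intro sum.mono_neutral_left) (auto simp: star_partitions_def not_in_iff)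
  with assms show ?thesis by (simp add: star_partitions_def)
qed

text \<open>Removing one copy of (p, q) inverts \<open>add_mset (p, q)\<close>. The guard protects
  against truncated subtraction.\<close>

lemma star_partitions_containing:
  assumes "(p, q) \<in> index_set_star M N"
  shows "{S \<in> star_partitions M N (Suc l) (i, j). (p, q) \<in># S} =
    (if p \<le> i \<and> q \<le> j then add_mset (p, q) ` star_partitions M N l (i - p, j - q) else {})"
proof -
  have "S \<in> {S \<in> star_partitions M N (Suc l) (i, j). (p, q) \<in># S} \<longleftrightarrow>
    p \<le> i \<and> q \<le> j \<and> S \<in> add_mset (p, q) ` star_partitions M N l (i - p, j - q)" for S
  proof (cases "(p, q) \<in># S")
    case True
    then obtain T where S: "S = add_mset (p, q) T" by (metis insert_DiffM)
    obtain u v where uv: "\<Sum>\<^sub># T = (u, v)" by fastforce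
    show ?thesis
      using assms by (auto simp: S uv star_partitions_def image_iff)
  qed auto
  then show ?thesis by auto
qed

text \<open>
  The multinomial theorem in recursive form: count the pairs \<open>(x, S)\<close> with \<open>x\<close> in \<open>S\<close>, each with weight
  the multiplicity of \<open>x\<close>, and remove one copy of \<open>x\<close> from \<open>S\<close>.
\<close>

lemma partition_sum_Suc:
  assumes ij: "(i, j) \<in> index_set M N"
  shows "of_nat (Suc l) * partition_sum M N A (Suc l) (i, j) =
    (\<Sum>(p, q) \<in> {0..i} \<times> {0..j} - {(0, 0)}.
       A $$ (p, q) * partition_sum M N A l (i - p, j - q))"
proof -
  let ?K = "index_set_star M N" and ?w = "partition_weight M N A"
  let ?P = "star_partitions M N (Suc l) (i, j)"
  have "of_nat (Suc l) * partition_sum M N A (Suc l) (i, j) = (\<Sum>S\<in>?P. of_nat (Suc l) * ?w S)"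
    by (simp add: partition_sum_def partition_weight_def sum_distrib_left)
  also have "\<dots> = (\<Sum>S\<in>?P. \<Sum>x\<in>?K. of_nat (count S x) * ?w S)"
  proof (rule sum.cong [OF refl])
    fix S assume "S \<in> ?P"
    from sum_count_index_set_star [OF this]
    show "of_nat (Suc l) * ?w S = (\<Sum>x\<in>?K. of_nat (count S x) * ?w S)"
      by (metis of_nat_sum sum_distrib_right)
  qed
  also have "\<dots> = (\<Sum>x\<in>?K. \<Sum>S\<in>?P. of_nat (count S x) * ?w S)"
    by (rule sum.swap)
  also have "\<dots> = (\<Sum>x\<in>?K. if fst x \<le> i \<and> snd x \<le> j
      then A $$ x * partition_sum M N A l (i - fst x, j - snd x) else 0)"
  proof (rule sum.cong [OF refl])
    fix x assume x: "x \<in> ?K"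
    obtain p q where pq: "x = (p, q)" by fastforce
    have "(\<Sum>S\<in>?P. of_nat (count S x) * ?w S) =
          (\<Sum>S\<in>{S \<in> ?P. x \<in># S}. of_nat (count S x) * ?w S)"
      by (rule sum.mono_neutral_right) (auto simp: finite_star_partitions not_in_iff)
    also have "\<dots> = (if p \<le> i \<and> q \<le> j then
        \<Sum>S\<in>star_partitions M N l (i - p, j - q). of_nat (count (add_mset x S) x) * ?w (add_mset x S)
        else 0)"
      unfolding pq star_partitions_containing [OF x [unfolded pq]]
      by (simp add: sum.reindex inj_on_def)
    also have "\<dots> = (if p \<le> i \<and> q \<le> j then A $$ x * partition_sum M N A l (i - p, j - q) else 0)"
      unfolding partition_weight_add_mset [OF x]
      by (simp add: partition_sum_def partition_weight_def sum_distrib_left)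
    finally show "(\<Sum>S\<in>?P. of_nat (count S x) * ?w S) = (if fst x \<le> i \<and> snd x \<le> j
        then A $$ x * partition_sum M N A l (i - fst x, j - snd x) else 0)"
      by (simp add: pq)
  qed
  \<comment> \<open>Since (i, j) is in range, the box below it, without the origin, lies in the
    index set; all other indices contribute 0.\<close>
  also have "\<dots> = (\<Sum>x\<in>{0..i} \<times> {0..j} - {(0, 0)}.
      A $$ x * partition_sum M N A l (i - fst x, j - snd x))"
    using ij by (intro sum.mono_neutral_cong_right) (auto simp: index_set_star_def index_set_def)
  finally show ?thesis by (simp add: case_prod_beta)
qed

subsection \<open>The Jury product as multiplication of power series\<close>

text \<open>The coefficients outside the index range of the matrix are unspecified junk; only those inside matter.\<close>

definition mat_fps :: "complex mat \<Rightarrow> complex fps fps" where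
  "mat_fps A = Abs_fps (\<lambda>i. Abs_fps (\<lambda>j. A $$ (i, j)))"

lemma coeff2_mat_fps [simp]: "coeff2 (mat_fps A) i j = A $$ (i, j)"
  by (simp add: coeff2_def mat_fps_def)

lemma jury_power_dim [simp]:
  "dim_row (jury_power A k) = dim_row A" "dim_col (jury_power A k) = dim_col A"
  by (induction k) (simp_all add: jury_one_def jury_prod_def)

text \<open>A coefficient of a product at (i, j) uses only coefficients at indices below (i, j), so
  entries outside the matrix never enter.\<close>

lemma jury_power_nth:
  assumes "i < dim_row A" "j < dim_col A"
  shows "jury_power A k $$ (i, j) = coeff2 (mat_fps A ^ k) i j"
  using assms
proof (induction k arbitrary: i j)
  case 0
  then show ?case by (simp add: jury_one_def coeff2_1)
next
  case (Suc k)
  have "jury_power A (Suc k) $$ (i, j) =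
    (\<Sum>l=0..i. \<Sum>m=0..j. jury_power A k $$ (l, m) * A $$ (i - l, j - m))"
    using Suc.prems by (simp add: jury_prod_def)
  also have "\<dots> = (\<Sum>l=0..i. \<Sum>m=0..j. coeff2 (mat_fps A ^ k) l m * A $$ (i - l, j - m))"
    using Suc.prems by (intro sum.cong refl) (simp add: Suc.IH)
  finally show ?case by (simp add: power_Suc2 coeff2_mult del: power_Suc)
qed

lemma jury_poly_nth:
  assumes "i < dim_row A" "j < dim_col A"
  shows "jury_poly f A $$ (i, j) = coeff2 (eval2 (mat_fps A) f) i j"
  using assms by (simp add: jury_poly_def eval2_altdef coeff2_sum jury_power_nth)

text \<open>Multiplying by the shifted series realizes the recursion
  \<open>partition_sum_Suc\<close>; the factor \<open>Suc l\<close> there builds up the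
  factorial.\<close>

lemma coeff2_shifted_power:
  assumes "(i, j) \<in> index_set M N"
  shows "coeff2 ((mat_fps A - const2 (A $$ (0, 0))) ^ l) i j = fact l * partition_sum M N A l (i, j)"
  using assms
proof (induction l arbitrary: i j)
  case 0
  then show ?case by (simp add: coeff2_1 partition_sum_0)
next
  case (Suc l)
  let ?B = "mat_fps A - const2 (A $$ (0, 0))"
  have IH: "coeff2 (?B ^ l) (i - p) (j - q) = fact l * partition_sum M N A l (i - p, j - q)" for p q
    using Suc.prems by (intro Suc.IH) (auto simp: index_set_def)
  have "coeff2 (?B ^ Suc l) i j =
    (\<Sum>x\<in>{0..i} \<times> {0..j}. coeff2 ?B (fst x) (snd x) * coeff2 (?B ^ l) (i - fst x) (j - snd x))"
    by (simp add: coeff2_mult sum.cartesian_product case_prod_beta del: coeff2_diff)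
  \<comment> \<open>The shifted series has constant term 0, which removes the origin, and agrees
    with \<open>A\<close> elsewhere.\<close>
  also have "\<dots> = (\<Sum>x\<in>{0..i} \<times> {0..j} - {(0, 0)}.
      A $$ x * (fact l * partition_sum M N A l (i - fst x, j - snd x)))"
    by (intro sum.mono_neutral_cong_right) (auto simp: coeff2_const2 IH)
  also have "\<dots> = fact l * (of_nat (Suc l) * partition_sum M N A (Suc l) (i, j))"
    unfolding partition_sum_Suc [OF Suc.prems]
    by (simp add: sum_distrib_left case_prod_beta mult_ac)
  finally show ?case by (simp add: algebra_simps)
qed

lemma eval2_linear_power:
  "eval2 (mat_fps A) ([:- c, 1:] ^ l) = (mat_fps A - const2 c) ^ l"
  by (simp add: const2_minus)

lemma jury_poly_nth_taylor:
  assumes A: "A \<in> carrier_mat M N" and ij: "(i, j) \<in> index_set M N"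
  shows "jury_poly f A $$ (i, j) =
    (\<Sum>l=0..i + j. poly ((pderiv ^^ l) f) (A $$ (0, 0)) * partition_sum M N A l (i, j))"
proof -
  let ?a = "A $$ (0, 0)"
  let ?t = "\<lambda>l. poly ((pderiv ^^ l) f) ?a * partition_sum M N A l (i, j)"
  have "jury_poly f A $$ (i, j) = coeff2 (eval2 (mat_fps A) f) i j"
    using A ij by (intro jury_poly_nth) (auto simp: index_set_def)
  also have "eval2 (mat_fps A) f =
    (\<Sum>l\<le>degree f. const2 (poly ((pderiv ^^ l) f) ?a / fact l) * (mat_fps A - const2 ?a) ^ l)"
    by (subst poly_taylor [of f ?a])
      (simp only: eval2_sum eval2_smult eval2_linear_power)
  also have "coeff2 \<dots> i j = (\<Sum>l\<le>degree f. ?t l)"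
    by (simp add: coeff2_sum coeff2_shifted_power [OF ij])
  \<comment> \<open>The bounds \<open>degree f\<close> and i + j are unrelated, so the sum passes
    through their maximum: derivatives vanish beyond the first, partition sums beyond the
    second.\<close>
  also have "\<dots> = (\<Sum>l\<le>max (degree f) (i + j). ?t l)"
    by (rule sum.mono_neutral_left) (auto simp: higher_pderiv_eq_0_of_degree_less)
  also have "\<dots> = (\<Sum>l=0..i + j. ?t l)"
    by (rule sum.mono_neutral_right) (auto simp: partition_sum_eq_0)
  finally show ?thesis .
qed

subsection \<open>The annihilator of a matrix\<close>

definition annihilates :: "complex poly \<Rightarrow> complex mat \<Rightarrow> bool" where
  "annihilates f A \<longleftrightarrow> jury_poly f A = 0\<^sub>m (dim_row A) (dim_col A)"

lemma annihilates_iff: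
  "annihilates f A \<longleftrightarrow> (\<forall>i<dim_row A. \<forall>j<dim_col A. coeff2 (eval2 (mat_fps A) f) i j = 0)"
proof -
  have "annihilates f A \<longleftrightarrow> (\<forall>i<dim_row A. \<forall>j<dim_col A. jury_poly f A $$ (i, j) = 0)"
    unfolding annihilates_def by (subst mat_eq_iff) (auto simp: jury_poly_def)
  then show ?thesis by (simp add: jury_poly_nth)
qed

text \<open>Series whose coefficients vanish on the whole index box form an ideal, hence so do the
  annihilating polynomials.\<close>

lemma annihilates_mult: "annihilates f A \<Longrightarrow> annihilates (f * g) A"
  by (auto simp: annihilates_iff coeff2_mult intro!: sum.neutral)

lemma annihilates_add: "annihilates f A \<Longrightarrow> annihilates g A \<Longrightarrow> annihilates (f + g) A"
  by (simp add: annihilates_iff)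

text \<open>Entries with i + j < k, which \<open>partition_sums_vanish\<close> does not test, vanish
  automatically by \<open>partition_sum_eq_0\<close>.\<close>

lemma annihilates_linear_power_iff:
  assumes "A \<in> carrier_mat M N"
  shows "annihilates ([:- A $$ (0, 0), 1:] ^ k) A \<longleftrightarrow> partition_sums_vanish M N A k"
proof -
  have "annihilates ([:- A $$ (0, 0), 1:] ^ k) A \<longleftrightarrow>
    (\<forall>(i, j)\<in>index_set M N. partition_sum M N A k (i, j) = 0)"
    using assms unfolding annihilates_iff eval2_linear_power
    by (auto simp: index_set_def coeff2_shifted_power [of _ _ M N])
  also have "\<dots> \<longleftrightarrow> partition_sums_vanish M N A k"
    by (auto simp: partition_sums_vanish_def partition_sum_eq_0 not_le)
  finally show ?thesis .
qed

text \<open>An annihilator q of degree at most k is (z - c)^m r with m \<le> k and r(c) nonzero. As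
  r is invertible modulo z - c, the ideal of annihilators would contain (z - c)^k.\<close>

lemma jury_minimal_poly_linear_power:
  assumes ann: "annihilates ([:- c, 1:] ^ Suc k) A" and nann: "\<not> annihilates ([:- c, 1:] ^ k) A"
  shows "jury_minimal_poly A ([:- c, 1:] ^ Suc k)"
proof -
  let ?z = "[:- c, 1:]"
  have False if q: "q \<noteq> 0" "degree q < Suc k" "annihilates q A" for q
  proof -
    define m where "m = order c q"
    obtain r where qr: "q = ?z ^ m * r" and "\<not> ?z dvd r"
      using order_decomp [OF q(1)] unfolding m_def by blast
    then have rc: "poly r c \<noteq> 0" by (simp add: poly_eq_0_iff_dvd)
    have "m \<le> k" using order_degree [OF q(1), of c] q(2) by (simp add: m_def)
    then have "?z ^ k * r = q * ?z ^ (k - m)"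
      by (simp add: qr power_add [symmetric] mult_ac flip: mult.assoc)
    with q(3) have "annihilates (?z ^ k * r) A" by (metis annihilates_mult)
    moreover obtain s where "r - [:poly r c:] = ?z * s"
      using poly_eq_0_iff_dvd [of "r - [:poly r c:]" c] by (auto elim: dvdE)
    then have r: "r = ?z * s + [:poly r c:]" by (simp add: algebra_simps)
    \<comment> \<open>This is 1 = (r - (z - c) s) / r(c) multiplied by (z - c)^k.\<close>
    have "?z ^ k = (?z ^ k * r) * [:1 / poly r c:] + ?z ^ Suc k * (- s * [:1 / poly r c:])"
    proof -
      have "(?z ^ k * r) * [:1 / poly r c:] + ?z ^ Suc k * (- s * [:1 / poly r c:]) =
        ?z ^ k * ((r - ?z * s) * [:1 / poly r c:])"
        by (simp only: power_Suc2 ring_distribs diff_conv_add_uminus mult_minus_left mult_minus_right mult_ac)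
      also have "r - ?z * s = [:poly r c:]" using r by (metis add_diff_cancel_left')
      finally show ?thesis using rc by (simp add: one_pCons)
    qed
    ultimately have "annihilates (?z ^ k) A"
      using ann by (metis annihilates_add annihilates_mult)
    with nann show False by contradiction
  qed
  moreover have "degree (?z ^ Suc k) = Suc k" by (simp only: degree_linear_power)
  moreover have "lead_coeff (?z ^ Suc k) = 1" by (simp only: lead_coeff_power) simp
  ultimately show ?thesis
    using ann unfolding jury_minimal_poly_def annihilates_def by fastforce
qed

theorem theorem7:
  fixes M N :: nat and A :: "complex mat"
  assumes "M \<ge> 1" and "N \<ge> 1" and "A \<in> carrier_mat M N"
  shows
    "(\<forall>f :: complex poly.
        jury_poly f A $$ (0, 0) = poly f (A $$ (0, 0)) \<and>
        (\<forall>(i, j) \<in> index_set_star M N.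
           jury_poly f A $$ (i, j) =
             (\<Sum>l = 1..i + j. poly ((pderiv ^^ l) f) (A $$ (0, 0)) * partition_sum M N A l (i, j)))) \<and>
     (\<forall>\<kappa> \<in> {1..M + N - 2}.
        partition_sums_vanish M N A \<kappa> \<and>
        (\<forall>k \<in> {1..M + N - 2}. partition_sums_vanish M N A k \<longrightarrow> \<kappa> \<le> k) \<longrightarrow>
        jury_minimal_poly A ([:- A $$ (0, 0), 1:] ^ \<kappa>)) \<and>
     ((\<nexists>\<kappa>. \<kappa> \<in> {1..M + N - 2} \<and> partition_sums_vanish M N A \<kappa>) \<longrightarrow>
        jury_minimal_poly A ([:- A $$ (0, 0), 1:] ^ (M + N - 1)))"
proof -
  let ?a = "A $$ (0, 0)"
  \<comment> \<open>Failure at the single exponent k - 1 already excludes every annihilator of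
    smaller degree.\<close>
  have min: "jury_minimal_poly A ([:- ?a, 1:] ^ k)"
    if "k \<ge> 1" "partition_sums_vanish M N A k" "\<not> partition_sums_vanish M N A (k - 1)" for k
    using jury_minimal_poly_linear_power [of ?a "k - 1" A] that
    by (simp add: annihilates_linear_power_iff [OF assms(3)] del: power_Suc)
  \<comment> \<open>The empty multiset gives the value 1 at the origin.\<close>
  have van0: "\<not> partition_sums_vanish M N A 0"
    using assms by (auto simp: partition_sums_vanish_def index_set_def partition_sum_0)
  have "jury_poly f A $$ (0, 0) = poly f ?a" for f
    using assms by (subst jury_poly_nth_taylor [of A M N]) (auto simp: index_set_def partition_sum_0)
  moreover have "jury_poly f A $$ (i, j) =
      (\<Sum>l=1..i + j. poly ((pderiv ^^ l) f) ?a * partition_sum M N A l (i, j))"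
    if "(i, j) \<in> index_set_star M N" for f i j
  proof -
    have "(i, j) \<in> index_set M N" "i \<noteq> 0 \<or> j \<noteq> 0" using that by (auto simp: index_set_star_def)
    then show ?thesis
      using assms(3) by (auto simp: jury_poly_nth_taylor sum.atLeast_Suc_atMost partition_sum_0)
  qed
  moreover have "jury_minimal_poly A ([:- ?a, 1:] ^ \<kappa>)"
    if \<kappa>: "\<kappa> \<in> {1..M + N - 2}" "partition_sums_vanish M N A \<kappa>"
      and least: "\<forall>k\<in>{1..M + N - 2}. partition_sums_vanish M N A k \<longrightarrow> \<kappa> \<le> k" for \<kappa>
  proof (rule min)
    show "\<not> partition_sums_vanish M N A (\<kappa> - 1)"
    \<comment> \<open>For \<kappa> = 1 the predecessor 0 lies outside the range of the minimality
      hypothesis, so \<open>van0\<close> is used.\<close>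
    proof (cases "\<kappa> = 1")
      case False
      then have "\<kappa> - 1 \<in> {1..M + N - 2}" "\<not> \<kappa> \<le> \<kappa> - 1" using \<kappa>(1) by auto
      with least show ?thesis by blast
    qed (use van0 in simp)
  qed (use \<kappa> in auto)
  moreover have "jury_minimal_poly A ([:- ?a, 1:] ^ (M + N - 1))"
    if none: "\<nexists>\<kappa>. \<kappa> \<in> {1..M + N - 2} \<and> partition_sums_vanish M N A \<kappa>"
  proof (rule min)
    \<comment> \<open>Vacuous: indices in range satisfy i + j \<le> M + N - 2.\<close>
    show "partition_sums_vanish M N A (M + N - 1)"
      by (auto simp: partition_sums_vanish_def index_set_def)
    show "\<not> partition_sums_vanish M N A (M + N - 1 - 1)"
    \<comment> \<open>If M = N = 1, the range of exponents is empty and the predecessor is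
      0.\<close>
    proof (cases "M + N - 2 = 0")
      case True
      then show ?thesis using van0 by (simp add: diff_diff_left numeral_2_eq_2)
    next
      case False
      then have "M + N - 1 - 1 \<in> {1..M + N - 2}" by auto
      with none show ?thesis by blast
    qed
  qed (use assms in simp)
  ultimately show ?thesis by blast
qed

end
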